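(* Let $k \ge 1$ be an integer, let $\alpha \in [0,1)$, $\sigma_N^2 > 0$ and $P_{tr} \ge 0$ be real numbers. Let $A$ be the $k \times k$ real matrix with entries $A_{st} = \alpha^{|s-t|}$ for $0 \le s,t \le k-1$, and let $V = (\alpha^{k-1}, \alpha^{k-2}, \ldots, \alpha, 1)^T \in \mathbb{R}^k$. For nonnegative reals $P_0, \ldots, P_{k-1}$ let $D = \mathrm{diag}(\sqrt{P_0}, \sqrt{P_1}, \ldots, \sqrt{P_{k-1}})$ and let $I$ be the $k\times k$ identity matrix. Then, among all choices of nonnegative reals $P_0, \ldots, P_{k-1}$ satisfying $$\sum_{s=0}^{k-1} P_s = k P_{tr},$$ the quantity $$V^T D^T \left[ D A D^T + \sigma_N^2 I \right]^{-1} D V$$ is maximized when $P_j = 0$ for all $0 \le j \le k-2$ and $P_{k-1} = k P_{tr}$.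
   Context: Convention: $0^0 = 1$, so that $A$ is the identity matrix and $V = (0,\ldots,0,1)^T$ when $\alpha = 0$. Interpretation (not needed for the claim): $A$ is the autocovariance matrix of $k$ consecutive unit-variance fading coefficients of a stationary first-order Gauss-Markov process $R_i = \alpha R_{i-1} + Z_i$; $P_0, \ldots, P_{k-1}$ are the powers of $k$ pilot symbols sent at times $0, \ldots, k-1$ with total budget $kP_{tr}$; $\sigma_N^2$ is the noise variance; and the error variance of the causal minimum mean-square error estimate of $R_j$, $j \ge k$, from the received pilots equals $1 - \alpha^{2(j-k+1)}$ times the displayed quantity. *)

theory Defs
  imports Complex_Main "Jordan_Normal_Form.Gauss_Jordan_Elimination" "Jordan_Normal_Form.Determinant"
begin

text \<open>
  Vectors and matrices are indexed from \<open>0\<close>, and \<open>0 ^ 0 = 1\<close>, so for \<open>\<alpha> = 0\<close> the autocovariance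
  matrix is the identity and the weight vector is the last unit vector.
\<close>

definition autocov_mat :: "nat \<Rightarrow> real \<Rightarrow> real mat" where
  "autocov_mat k \<alpha> = mat k k (\<lambda>(s, t). \<alpha> ^ nat \<bar>int s - int t\<bar>)"

definition weight_vec :: "nat \<Rightarrow> real \<Rightarrow> real vec" where
  "weight_vec k \<alpha> = vec k (\<lambda>s. \<alpha> ^ (k - 1 - s))"

definition pilot_mat :: "nat \<Rightarrow> real vec \<Rightarrow> real mat" where
  "pilot_mat k P = mat_diag k (\<lambda>s. sqrt (P $ s))"

definition received_cov :: "nat \<Rightarrow> real \<Rightarrow> real \<Rightarrow> real vec \<Rightarrow> real mat" where
  "received_cov k \<alpha> \<sigma>2 P =
     pilot_mat k P * autocov_mat k \<alpha> * (pilot_mat k P)\<^sup>T + \<sigma>2 \<cdot>\<^sub>m 1\<^sub>m k"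

text \<open>
  The inverse below always exists in the range of interest, see \<open>received_cov_inverse\<close>. The parameter
  \<open>\<sigma>2\<close> is the noise variance itself, not its square root.
\<close>

definition pilot_objective :: "nat \<Rightarrow> real \<Rightarrow> real \<Rightarrow> real vec \<Rightarrow> real" where
  "pilot_objective k \<alpha> \<sigma>2 P =
     weight_vec k \<alpha> \<bullet> ((pilot_mat k P)\<^sup>T *\<^sub>v
       (the (mat_inverse (received_cov k \<alpha> \<sigma>2 P)) *\<^sub>v (pilot_mat k P *\<^sub>v weight_vec k \<alpha>)))"

definition power_allocation :: "nat \<Rightarrow> real \<Rightarrow> real vec \<Rightarrow> bool" where
  "power_allocation k Ptr P \<longleftrightarrow>
     P \<in> carrier_vec k \<and> (\<forall>s<k. 0 \<le> P $ s) \<and> (\<Sum>s<k. P $ s) = real k * Ptr"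

lemma autocov_sum_ge:
  fixes \<alpha> :: real and y :: "nat \<Rightarrow> real"
  assumes "\<bar>\<alpha>\<bar> \<le> 1"
  shows "(\<Sum>s<k. \<alpha> ^ (k - s) * y s)\<^sup>2 \<le> (\<Sum>s<k. \<Sum>t<k. y s * (\<alpha> ^ nat \<bar>int s - int t\<bar> * y t))"
proof (induction k)
  case 0
  then show ?case by simp
next
  case (Suc k)
  define W where "W = (\<Sum>s<k. \<alpha> ^ (k - s) * y s)"
  define Q where "Q = (\<Sum>s<k. \<Sum>t<k. y s * (\<alpha> ^ nat \<bar>int s - int t\<bar> * y t))"
  have W_Suc: "(\<Sum>s<Suc k. \<alpha> ^ (Suc k - s) * y s) = \<alpha> * (W + y k)"
    by (simp add: W_def sum_distrib_left Suc_diff_le algebra_simps)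
  have e1: "(\<Sum>s<k. y s * (\<alpha> ^ nat \<bar>int s - int k\<bar> * y k)) = y k * W"
    unfolding W_def sum_distrib_left
    by (intro sum.cong refl) (auto simp: nat_diff_distrib abs_if)
  have e2: "(\<Sum>t<k. y k * (\<alpha> ^ nat \<bar>int k - int t\<bar> * y t)) = y k * W"
    unfolding W_def sum_distrib_left
    by (intro sum.cong refl) (auto simp: nat_diff_distrib abs_if)
  have Q_Suc: "(\<Sum>s<Suc k. \<Sum>t<Suc k. y s * (\<alpha> ^ nat \<bar>int s - int t\<bar> * y t))
      = Q + 2 * (y k * W) + (y k)\<^sup>2"
    using e1 e2 by (simp add: sum.distrib Q_def power2_eq_square)
  have "(\<alpha> * (W + y k))\<^sup>2 \<le> (W + y k)\<^sup>2"
    using assms by (simp add: power_mult_distrib mult_left_le_one_le abs_square_le_1)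
  also have "\<dots> \<le> Q + 2 * (y k * W) + (y k)\<^sup>2"
    using Suc.IH by (simp add: W_def[symmetric] Q_def[symmetric] power2_sum)
  finally show ?case by (simp only: W_Suc Q_Suc)
qed

lemma autocov_mat_psd:
  assumes "\<bar>\<alpha>\<bar> \<le> 1" and y: "y \<in> carrier_vec k"
  shows "0 \<le> y \<bullet> (autocov_mat k \<alpha> *\<^sub>v y)"
proof -
  have "y \<bullet> (autocov_mat k \<alpha> *\<^sub>v y)
      = (\<Sum>s<k. \<Sum>t<k. y $ s * (\<alpha> ^ nat \<bar>int s - int t\<bar> * y $ t))"
    using y by (simp add: autocov_mat_def scalar_prod_def sum_distrib_left atLeast0LessThan)
  moreover have "0 \<le> (\<Sum>s<k. \<alpha> ^ (k - s) * y $ s)\<^sup>2"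
    by simp
  ultimately show ?thesis
    using autocov_sum_ge[OF assms(1), where k = k and y = "\<lambda>s. y $ s"] by linarith
qed

lemma received_cov_inverse:
  assumes \<alpha>: "\<bar>\<alpha>\<bar> \<le> 1" and \<sigma>: "0 < \<sigma>2"
  obtains B where "mat_inverse (received_cov k \<alpha> \<sigma>2 P) = Some B" "B \<in> carrier_mat k k"
    "received_cov k \<alpha> \<sigma>2 P * B = 1\<^sub>m k" "B * received_cov k \<alpha> \<sigma>2 P = 1\<^sub>m k"
proof -
  let ?D = "pilot_mat k P" and ?A = "autocov_mat k \<alpha>" and ?M = "received_cov k \<alpha> \<sigma>2 P"
  have D: "?D \<in> carrier_mat k k" and A: "?A \<in> carrier_mat k k"
    by (auto simp: pilot_mat_def autocov_mat_def)
  have M: "?M \<in> carrier_mat k k"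
    using D A by (simp add: received_cov_def)
  have "det ?M \<noteq> 0"
  proof
    assume "det ?M = 0"
    then obtain v where v: "v \<in> carrier_vec k" "v \<noteq> 0\<^sub>v k" "?M *\<^sub>v v = 0\<^sub>v k"
      using det_0_iff_vec_prod_zero_field[OF M] by blast
    define y where "y = ?D\<^sup>T *\<^sub>v v"
    have y: "y \<in> carrier_vec k"
      using D v by (simp add: y_def)
    have "?M *\<^sub>v v = (?D * ?A * ?D\<^sup>T) *\<^sub>v v + (\<sigma>2 \<cdot>\<^sub>m 1\<^sub>m k) *\<^sub>v v"
      unfolding received_cov_def
      by (rule add_mult_distrib_mat_vec[where nr = k and nc = k]) (use D A v in auto)
    moreover have "(?D * ?A * ?D\<^sup>T) *\<^sub>v v = ?D *\<^sub>v (?A *\<^sub>v y)"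
      unfolding y_def using D A v
      by (simp add: assoc_mult_mat_vec[where n\<^sub>1 = k and n\<^sub>2 = k and n\<^sub>3 = k])
    moreover have "(\<sigma>2 \<cdot>\<^sub>m 1\<^sub>m k) *\<^sub>v v = \<sigma>2 \<cdot>\<^sub>v v"
      using v by (auto intro!: eq_vecI simp: row_smult)
    ultimately have "?M *\<^sub>v v = ?D *\<^sub>v (?A *\<^sub>v y) + \<sigma>2 \<cdot>\<^sub>v v"
      by simp
    then have "v \<bullet> (?M *\<^sub>v v) = v \<bullet> (?D *\<^sub>v (?A *\<^sub>v y)) + \<sigma>2 * (v \<bullet> v)"
      using v y D A by (simp add: scalar_prod_add_distrib[where n = k])
    also have "v \<bullet> (?D *\<^sub>v (?A *\<^sub>v y)) = y \<bullet> (?A *\<^sub>v y)"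
      unfolding y_def
      by (rule transpose_vec_mult_scalar[OF D, symmetric]) (use A v y in \<open>auto simp: y_def\<close>)
    finally have "y \<bullet> (?A *\<^sub>v y) + \<sigma>2 * (v \<bullet> v) = 0"
      using v by simp
    moreover have "0 < v \<bullet> v"
    proof -
      obtain i where i: "i < k" "v $ i \<noteq> 0"
        using v by (auto simp: vec_eq_iff)
      have "0 < (\<Sum>j\<in>{0..<k}. v $ j * v $ j)"
        by (rule sum_pos2[where i = i]) (use i in \<open>auto simp: zero_less_mult_iff\<close>)
      then show ?thesis
        using v by (simp add: scalar_prod_def)
    qed
    ultimately show False
      using autocov_mat_psd[OF \<alpha> y] \<sigma> by (smt (verit) mult_pos_pos)
  qed
  then have "?M \<in> Units (ring_mat TYPE(real) k ())"
    by (rule det_non_zero_imp_unit[OF M])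
  then obtain B where "mat_inverse ?M = Some B"
    using mat_inverse(1)[OF M, where b = "()"] by (cases "mat_inverse ?M") auto
  then show thesis
    using that mat_inverse(2)[OF M] by blast
qed

end

(* Put u = M^{-1} D V with M = D A D^T + sigma2 I, and y = D u. The objective J equals V . y and also
   u . M u = y . A y + sigma2 |u|^2. Two Cauchy-Schwarz bounds control the terms on the right: V = A e
   for the last unit vector e, with e . A e = 1, so J^2 <= y . A y; and J = D V . u with
   |D V|^2 <= S = k Ptr, so J^2 <= S |u|^2. Hence J^2 (S + sigma2) <= S J, that is,
   J <= S / (S + sigma2), which is the value attained by putting all the power on the last pilot. *)

theory Submission
  imports Defs "HOL-Analysis.Convex"
begin

lemma weight_vec_carrier [simp]: "weight_vec k \<alpha> \<in> carrier_vec k"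
  by (simp add: weight_vec_def)

lemma weight_vec_dim [simp]: "dim_vec (weight_vec k \<alpha>) = k"
  by (simp add: weight_vec_def)

lemma autocov_mat_carrier [simp]: "autocov_mat k \<alpha> \<in> carrier_mat k k"
  by (simp add: autocov_mat_def)

lemma autocov_mat_dim [simp]: "dim_row (autocov_mat k \<alpha>) = k" "dim_col (autocov_mat k \<alpha>) = k"
  using autocov_mat_carrier by (blast dest: carrier_matD)+

lemma pilot_mat_carrier [simp]: "pilot_mat k P \<in> carrier_mat k k"
  by (simp add: pilot_mat_def)

lemma pilot_mat_dim [simp]: "dim_row (pilot_mat k P) = k" "dim_col (pilot_mat k P) = k"
  using pilot_mat_carrier by (blast dest: carrier_matD)+

lemma received_cov_carrier [simp]: "received_cov k \<alpha> \<sigma>2 P \<in> carrier_mat k k"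
  by (simp add: received_cov_def)

lemma pilot_mat_transpose [simp]: "(pilot_mat k P)\<^sup>T = pilot_mat k P"
  by (auto simp: pilot_mat_def mat_diag_def intro!: eq_matI)

lemma pilot_mat_mult_vec:
  assumes "v \<in> carrier_vec k"
  shows "pilot_mat k P *\<^sub>v v = vec k (\<lambda>s. sqrt (P $ s) * v $ s)"
proof (rule eq_vecI)
  fix i assume "i < dim_vec (vec k (\<lambda>s. sqrt (P $ s) * v $ s))"
  then have i: "i < k" by simp
  have "(pilot_mat k P *\<^sub>v v) $ i = (\<Sum>j<k. (if i = j then sqrt (P $ j) else 0) * v $ j)"
    using assms i by (simp add: pilot_mat_def mat_diag_def scalar_prod_def atLeast0LessThan)
  also have "\<dots> = (\<Sum>j<k. if i = j then sqrt (P $ j) * v $ j else 0)"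
    by (rule sum.cong) auto
  also have "\<dots> = sqrt (P $ i) * v $ i"
    using i by simp
  finally show "(pilot_mat k P *\<^sub>v v) $ i = vec k (\<lambda>s. sqrt (P $ s) * v $ s) $ i"
    using i by simp
qed simp

text \<open>Unfolds the matrix product into successive actions on a vector, so that the later
  arguments only deal with \<open>D v\<close>, \<open>A (D v)\<close> and scalar products.\<close>

lemma received_cov_mult_vec:
  assumes v: "v \<in> carrier_vec k"
  shows "received_cov k \<alpha> \<sigma>2 P *\<^sub>v v =
    pilot_mat k P *\<^sub>v (autocov_mat k \<alpha> *\<^sub>v (pilot_mat k P *\<^sub>v v)) + \<sigma>2 \<cdot>\<^sub>v v"
proof -
  let ?D = "pilot_mat k P" and ?A = "autocov_mat k \<alpha>"
  have D: "?D \<in> carrier_mat k k" and A: "?A \<in> carrier_mat k k" by simp_all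
  have "received_cov k \<alpha> \<sigma>2 P *\<^sub>v v = (?D * ?A * ?D) *\<^sub>v v + (\<sigma>2 \<cdot>\<^sub>m 1\<^sub>m k) *\<^sub>v v"
    unfolding received_cov_def pilot_mat_transpose
    by (rule add_mult_distrib_mat_vec[where nr = k and nc = k])
      (use v in \<open>auto intro!: mult_carrier_mat[where n = k]\<close>)
  moreover have "(?D * ?A * ?D) *\<^sub>v v = ?D *\<^sub>v (?A *\<^sub>v (?D *\<^sub>v v))"
    using v mult_mat_vec_carrier[OF D v] mult_carrier_mat[OF D A]
    by (simp add: assoc_mult_mat_vec[OF _ D v] assoc_mult_mat_vec[OF D A])
  moreover have "(\<sigma>2 \<cdot>\<^sub>m 1\<^sub>m k) *\<^sub>v v = \<sigma>2 \<cdot>\<^sub>v v"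
    using v by (auto intro!: eq_vecI simp: row_smult)
  ultimately show ?thesis by simp
qed

text \<open>Trades the inverse for a solution of a linear system: \<open>u = B (D V)\<close> solves
  it because \<open>B\<close> is a right inverse.\<close>

lemma pilot_objective_solution:
  assumes "\<bar>\<alpha>\<bar> \<le> 1" and "0 < \<sigma>2"
  obtains u where "u \<in> carrier_vec k"
    "received_cov k \<alpha> \<sigma>2 P *\<^sub>v u = pilot_mat k P *\<^sub>v weight_vec k \<alpha>"
    "pilot_objective k \<alpha> \<sigma>2 P = weight_vec k \<alpha> \<bullet> (pilot_mat k P *\<^sub>v u)"
proof -
  let ?W = "pilot_mat k P *\<^sub>v weight_vec k \<alpha>" and ?M = "received_cov k \<alpha> \<sigma>2 P"
  have W: "?W \<in> carrier_vec k"
    by (rule mult_mat_vec_carrier[where n = k]) simp_all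
  obtain B where B: "mat_inverse ?M = Some B" "B \<in> carrier_mat k k" "?M * B = 1\<^sub>m k"
    using received_cov_inverse[OF assms] by metis
  show thesis
  proof (rule that)
    show "B *\<^sub>v ?W \<in> carrier_vec k"
      using B W by simp
    have "?M *\<^sub>v (B *\<^sub>v ?W) = (?M * B) *\<^sub>v ?W"
      by (rule assoc_mult_mat_vec[symmetric, where n\<^sub>1 = k and n\<^sub>2 = k]) (use B W in auto)
    then show "?M *\<^sub>v (B *\<^sub>v ?W) = ?W"
      using B W by simp
    show "pilot_objective k \<alpha> \<sigma>2 P = weight_vec k \<alpha> \<bullet> (pilot_mat k P *\<^sub>v (B *\<^sub>v ?W))"
      by (simp add: pilot_objective_def B)
  qed
qed

text \<open>Conversely, \<open>B\<close> is also a left inverse, so the system has only one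
  solution. Guessing a solution is therefore enough to evaluate the objective, and no inverse has to
  be computed.\<close>

lemma pilot_objective_eq:
  assumes "\<bar>\<alpha>\<bar> \<le> 1" and "0 < \<sigma>2" and x: "x \<in> carrier_vec k"
    and eq: "received_cov k \<alpha> \<sigma>2 P *\<^sub>v x = pilot_mat k P *\<^sub>v weight_vec k \<alpha>"
  shows "pilot_objective k \<alpha> \<sigma>2 P = weight_vec k \<alpha> \<bullet> (pilot_mat k P *\<^sub>v x)"
proof -
  let ?M = "received_cov k \<alpha> \<sigma>2 P"
  obtain B where B: "mat_inverse ?M = Some B" "B \<in> carrier_mat k k" "B * ?M = 1\<^sub>m k"
    using received_cov_inverse[OF assms(1,2)] by metis
  have "B *\<^sub>v (?M *\<^sub>v x) = (B * ?M) *\<^sub>v x"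
    by (rule assoc_mult_mat_vec[symmetric, where n\<^sub>1 = k and n\<^sub>2 = k]) (use B x in auto)
  then show ?thesis
    using B x by (simp add: pilot_objective_def eq)
qed

text \<open>The weights are the last column of the autocovariance matrix, since |s - (k - 1)| = k -
  1 - s for s < k. This turns \<open>V . y\<close> into a product of \<open>y\<close> with the last
  unit vector in the form given by \<open>A\<close>.\<close>

lemma autocov_mat_mult_last:
  assumes "1 \<le> k"
  shows "autocov_mat k \<alpha> *\<^sub>v unit_vec k (k - 1) = weight_vec k \<alpha>"
  using assms
  by (intro eq_vecI)
    (auto simp: autocov_mat_def weight_vec_def nat_diff_distrib abs_if of_nat_diff
      intro!: arg_cong[where f = "power \<alpha>"])

lemma autocov_mat_transpose [simp]: "(autocov_mat k \<alpha>)\<^sup>T = autocov_mat k \<alpha>"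
  by (auto simp: autocov_mat_def abs_minus_commute intro!: eq_matI)

text \<open>Cauchy-Schwarz for the semidefinite form of \<open>A\<close>, applied to
  \<open>y\<close> and the last unit vector \<open>e\<close>. It is proved by evaluating the form at
  \<open>y - c e\<close>, where \<open>c e\<close> is the projection of \<open>y\<close> onto
  \<open>e\<close> with respect to \<open>A\<close>.\<close>

lemma autocov_quadratic_ge:
  assumes "1 \<le> k" and "\<bar>\<alpha>\<bar> \<le> 1" and y: "y \<in> carrier_vec k"
  shows "(weight_vec k \<alpha> \<bullet> y)\<^sup>2 \<le> y \<bullet> (autocov_mat k \<alpha> *\<^sub>v y)"
proof -
  let ?A = "autocov_mat k \<alpha>" and ?e = "unit_vec k (k - 1) :: real vec" and ?V = "weight_vec k \<alpha>"
  define c where "c = ?V \<bullet> y"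
  have A: "?A \<in> carrier_mat k k" by simp
  have Ay: "?A *\<^sub>v y \<in> carrier_vec k"
    using y by (rule mult_mat_vec_carrier[OF A])
  have z: "y - c \<cdot>\<^sub>v ?e \<in> carrier_vec k"
    using y by simp
  have Az: "?A *\<^sub>v (y - c \<cdot>\<^sub>v ?e) = ?A *\<^sub>v y - c \<cdot>\<^sub>v ?V"
    using y autocov_mat_mult_last[OF assms(1)]
    by (simp add: mult_minus_distrib_mat_vec[OF A] mult_mat_vec[OF A])
  \<comment> \<open>By symmetry \<open>A\<close> moves onto \<open>e\<close>, where it yields
    \<open>V\<close>.\<close>
  have eAy: "?e \<bullet> (?A *\<^sub>v y) = c"
    using transpose_vec_mult_scalar[OF A y, of ?e] autocov_mat_mult_last[OF assms(1)]
    by (simp add: c_def)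
  \<comment> \<open>This is \<open>e . A e\<close>: the last weight is \<alpha> to the power
    0.\<close>
  have eV: "?e \<bullet> ?V = 1"
    using assms(1) by (subst scalar_prod_left_unit[where n = k]) (auto simp: weight_vec_def)
  have yV: "y \<bullet> ?V = c"
    using comm_scalar_prod[OF y weight_vec_carrier] by (simp add: c_def)
  have "0 \<le> (y - c \<cdot>\<^sub>v ?e) \<bullet> (?A *\<^sub>v (y - c \<cdot>\<^sub>v ?e))"
    by (rule autocov_mat_psd[OF assms(2) z])
  also have "\<dots> = y \<bullet> (?A *\<^sub>v y) - c\<^sup>2"
    unfolding Az using y Ay eAy eV yV
    by (simp del: One_nat_def add: minus_scalar_prod_distrib[where n = k] scalar_prod_minus_distrib[where n = k]
        power2_eq_square)
  finally show ?thesis by (simp add: c_def)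
qed

text \<open>Every weight is a power of \<alpha>, hence at most 1 in absolute value, so each squared
  entry is bounded by the power spent on that pilot.\<close>

lemma pilot_weight_norm_le:
  assumes "\<bar>\<alpha>\<bar> \<le> 1" and "power_allocation k Ptr P"
  shows "(\<Sum>s<k. ((pilot_mat k P *\<^sub>v weight_vec k \<alpha>) $ s)\<^sup>2) \<le> real k * Ptr"
proof -
  have "((pilot_mat k P *\<^sub>v weight_vec k \<alpha>) $ s)\<^sup>2 \<le> P $ s" if "s < k" for s
  proof -
    have "(weight_vec k \<alpha> $ s)\<^sup>2 \<le> 1"
      using that assms(1) by (simp add: weight_vec_def abs_square_le_1 power_abs power_le_one)
    then show ?thesis
      using that assms(2)
      by (simp add: pilot_mat_mult_vec power_mult_distrib power_allocation_def mult_left_le)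
  qed
  then have "(\<Sum>s<k. ((pilot_mat k P *\<^sub>v weight_vec k \<alpha>) $ s)\<^sup>2) \<le> (\<Sum>s<k. P $ s)"
    by (intro sum_mono) simp
  then show ?thesis
    using assms(2) by (simp add: power_allocation_def)
qed

lemma pilot_objective_le:
  assumes k: "1 \<le> k" and \<alpha>: "\<bar>\<alpha>\<bar> \<le> 1" and \<sigma>: "0 < \<sigma>2" and P: "power_allocation k Ptr P"
  shows "pilot_objective k \<alpha> \<sigma>2 P \<le> real k * Ptr / (real k * Ptr + \<sigma>2)"
proof -
  let ?D = "pilot_mat k P" and ?A = "autocov_mat k \<alpha>" and ?V = "weight_vec k \<alpha>"
  define S where "S = real k * Ptr"
  obtain u where u: "u \<in> carrier_vec k" "received_cov k \<alpha> \<sigma>2 P *\<^sub>v u = ?D *\<^sub>v ?V"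
    and J: "pilot_objective k \<alpha> \<sigma>2 P = ?V \<bullet> (?D *\<^sub>v u)"
    using pilot_objective_solution[OF \<alpha> \<sigma>] by metis
  define J where "J = ?V \<bullet> (?D *\<^sub>v u)"
  define N where "N = (\<Sum>s<k. (u $ s)\<^sup>2)"
  define y where "y = ?D *\<^sub>v u"
  have D: "?D \<in> carrier_mat k k" and A: "?A \<in> carrier_mat k k" by simp_all
  have y: "y \<in> carrier_vec k"
    unfolding y_def by (rule mult_mat_vec_carrier[OF D u(1)])
  have Ay: "?A *\<^sub>v y \<in> carrier_vec k"
    by (rule mult_mat_vec_carrier[OF A y])
  \<comment> \<open>The diagonal matrix is its own transpose and can be moved across the scalar
    product.\<close>
  have D_adjoint: "u \<bullet> (?D *\<^sub>v v) = y \<bullet> v" if "v \<in> carrier_vec k" for v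
    using transpose_vec_mult_scalar[OF D that u(1)] by (simp add: y_def)
  have uDV: "u \<bullet> (?D *\<^sub>v ?V) = J"
    using D_adjoint[of ?V] comm_scalar_prod[OF y weight_vec_carrier] by (simp add: J_def y_def)
  have uu: "u \<bullet> u = N"
    using u by (simp add: N_def scalar_prod_def power2_eq_square atLeast0LessThan)
  have DAy: "?D *\<^sub>v (?A *\<^sub>v y) \<in> carrier_vec k"
    by (rule mult_mat_vec_carrier[OF D Ay])
  have "J = u \<bullet> (?D *\<^sub>v (?A *\<^sub>v y) + \<sigma>2 \<cdot>\<^sub>v u)"
    using uDV u(2) received_cov_mult_vec[OF u(1)] by (simp add: y_def)
  also have "\<dots> = y \<bullet> (?A *\<^sub>v y) + \<sigma>2 * N"
    using u(1) DAy D_adjoint[OF Ay] uu by (simp add: scalar_prod_add_distrib[where n = k])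
  finally have J_eq: "J = y \<bullet> (?A *\<^sub>v y) + \<sigma>2 * N" .
  then have J_ge: "J\<^sup>2 + \<sigma>2 * N \<le> J"
    using autocov_quadratic_ge[OF k \<alpha> y] by (simp add: J_def y_def)
  have N0: "0 \<le> N"
    by (simp add: N_def sum_nonneg)
  \<comment> \<open>The budget is a sum of nonnegative powers.\<close>
  have S0: "0 \<le> S"
    using P unfolding power_allocation_def S_def by (metis sum_nonneg lessThan_iff)
  have "J\<^sup>2 = (\<Sum>s<k. (?D *\<^sub>v ?V) $ s * u $ s)\<^sup>2"
    using uDV D by (simp add: scalar_prod_def atLeast0LessThan mult.commute)
  also have "\<dots> \<le> (\<Sum>s<k. ((?D *\<^sub>v ?V) $ s)\<^sup>2) * N"
    unfolding N_def by (rule Cauchy_Schwarz_ineq_sum)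
  also have "\<dots> \<le> S * N"
    unfolding S_def using N0 by (intro mult_right_mono pilot_weight_norm_le[OF \<alpha> P])
  finally have "\<sigma>2 * J\<^sup>2 \<le> \<sigma>2 * (S * N)"
    using \<sigma> by simp
  \<comment> \<open>The factors \<open>\<sigma>2\<close> and \<open>S\<close> are chosen so that the
    unknown term \<open>S * \<sigma>2 * N\<close> cancels when the two inequalities are
    added.\<close>
  moreover have "S * (J\<^sup>2 + \<sigma>2 * N) \<le> S * J"
    using J_ge S0 by (rule mult_left_mono)
  ultimately have "J * (J * (S + \<sigma>2)) \<le> J * S"
    by (simp add: algebra_simps power2_eq_square)
  moreover have "0 \<le> J"
    using J_ge N0 \<sigma> by (smt (verit) mult_nonneg_nonneg zero_le_power2)
  \<comment> \<open>For positive \<open>J\<close> one factor \<open>J\<close> cancels; for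
    \<open>J = 0\<close> the claim is just that \<open>S\<close> is nonnegative.\<close>
  ultimately have "J * (S + \<sigma>2) \<le> S"
    using S0 by (cases "J = 0") auto
  then have "J \<le> S / (S + \<sigma>2)"
    using S0 \<sigma> by (simp add: pos_le_divide_eq)
  then show ?thesis
    using J by (simp add: J_def S_def)
qed

text \<open>With all power on the last pilot, \<open>D\<close> annihilates every coordinate but the
  last, so the system reduces to one scalar equation along \<open>e\<close>.\<close>

lemma pilot_objective_last:
  assumes k: "1 \<le> k" and \<alpha>: "\<bar>\<alpha>\<bar> \<le> 1" and \<sigma>: "0 < \<sigma>2" and S: "0 \<le> S"
  shows "pilot_objective k \<alpha> \<sigma>2 (vec k (\<lambda>j. if j = k - 1 then S else 0)) = S / (S + \<sigma>2)"
proof -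
  let ?P = "vec k (\<lambda>j. if j = k - 1 then S else 0)"
  let ?D = "pilot_mat k ?P" and ?e = "unit_vec k (k - 1) :: real vec" and ?V = "weight_vec k \<alpha>"
  \<comment> \<open>Here \<open>e\<close> is an eigenvector of the received covariance with
    eigenvalue \<open>S + \<sigma>2\<close>, and the right-hand side is \<open>sqrt S\<close> times
    \<open>e\<close>; \<open>c\<close> is the quotient.\<close>
  define c where "c = sqrt S / (S + \<sigma>2)"
  have D: "?D \<in> carrier_mat k k" by simp
  have A: "autocov_mat k \<alpha> \<in> carrier_mat k k" by simp
  have De: "?D *\<^sub>v ?e = sqrt S \<cdot>\<^sub>v ?e"
    by (subst pilot_mat_mult_vec) (auto intro!: eq_vecI)
  have DV: "?D *\<^sub>v ?V = sqrt S \<cdot>\<^sub>v ?e"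
    by (subst pilot_mat_mult_vec) (auto intro!: eq_vecI simp: weight_vec_def)
  have Dce: "?D *\<^sub>v (c \<cdot>\<^sub>v ?e) = (c * sqrt S) \<cdot>\<^sub>v ?e"
    by (simp del: One_nat_def add: mult_mat_vec[OF D] De smult_smult_assoc)
  have "received_cov k \<alpha> \<sigma>2 ?P *\<^sub>v (c \<cdot>\<^sub>v ?e) = (c * (S + \<sigma>2)) \<cdot>\<^sub>v ?e"
    using S autocov_mat_mult_last[OF k, of \<alpha>]
    by (simp del: One_nat_def add: received_cov_mult_vec Dce mult_mat_vec[OF A] mult_mat_vec[OF D] DV
        smult_smult_assoc add_smult_distrib_vec[symmetric] algebra_simps)
  also have "c * (S + \<sigma>2) = sqrt S"
    using S \<sigma> by (simp add: c_def)
  finally have "pilot_objective k \<alpha> \<sigma>2 ?P = ?V \<bullet> (?D *\<^sub>v (c \<cdot>\<^sub>v ?e))"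
    using DV by (intro pilot_objective_eq[OF \<alpha> \<sigma>]) simp_all
  also have "\<dots> = c * sqrt S * (?V \<bullet> ?e)"
    by (simp del: One_nat_def add: Dce scalar_prod_smult_right)
  also have "?V \<bullet> ?e = 1"
    using k by (subst scalar_prod_right_unit) (auto simp: weight_vec_def)
  finally show ?thesis
    using S by (simp add: c_def)
qed

theorem theorem1:
  fixes k :: nat and \<alpha> \<sigma>2 Ptr :: real
  assumes "1 \<le> k" and "0 \<le> \<alpha>" and "\<alpha> < 1" and "0 < \<sigma>2" and "0 \<le> Ptr"
  shows "is_arg_max (pilot_objective k \<alpha> \<sigma>2) (power_allocation k Ptr)
           (vec k (\<lambda>j. if j = k - 1 then real k * Ptr else 0))"
proof -
  have \<alpha>: "\<bar>\<alpha>\<bar> \<le> 1" and S: "0 \<le> real k * Ptr"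
    using assms by simp_all
  have "power_allocation k Ptr (vec k (\<lambda>j. if j = k - 1 then real k * Ptr else 0))"
    using assms(1) S by (simp add: power_allocation_def)
  then show ?thesis
    \<comment> \<open>The upper bound depends on the allocation only through its total, so it is
      common to all competitors and equals the value at the candidate.\<close>
    using pilot_objective_le[OF assms(1) \<alpha> assms(4), of Ptr]
    by (auto simp del: One_nat_def simp: is_arg_max_def pilot_objective_last[OF assms(1) \<alpha> assms(4) S] not_less)
qed

end
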